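(* Let $n>9$ be an integer. Then \[ \sum_{k=0}^{n-1}\frac{(q^{-1};q^9)_k^2\,(q^{-7};q^9)_k\, q^{9k}}{(q^9;q^9)_k^3}\equiv 0 \pmod{\Phi_n(q)^2}\quad\text{if } n\equiv 5\pmod 9, \] \[ \sum_{k=0}^{n-1}\frac{(q^{-2};q^9)_k^2\,(q^{-5};q^9)_k\, q^{9k}}{(q^9;q^9)_k^3}\equiv 0 \pmod{\Phi_n(q)^2}\quad\text{if } n\equiv 2,5\pmod 9, \] \[ \sum_{k=0}^{n-1}\frac{(q^{-4};q^9)_k^2\,(q^{-1};q^9)_k\, q^{9k}}{(q^9;q^9)_k^3}\equiv 0 \pmod{\Phi_n(q)^2}\quad\text{if } n\equiv 2\pmod 9. \]
   Context: $(a;q)_k=(1-a)(1-aq)\cdots(1-aq^{k-1})$ (with $(a;q)_0=1$) is the $q$-shifted factorial; $\Phi_n(q)$ is the $n$-th cyclotomic polynomial. A congruence of a rational function in $q$ modulo a polynomial $P(q)$, where the denominator is coprime to $P(q)$, means that $P(q)$ divides the numerator (in the ring of Laurent polynomials in $q$ with rational coefficients). *)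

theory Defs
  imports
    Complex_Main
    "HOL-Computational_Algebra.Computational_Algebra"
    "HOL-Number_Theory.Cong"
begin

definition qpochhammer :: "'a :: comm_ring_1 \<Rightarrow> 'a \<Rightarrow> nat \<Rightarrow> 'a" where
  "qpochhammer a q k = (\<Prod>i<k. 1 - a * q ^ i)"

section \<open>Cyclotomic polynomials over the rationals\<close>

definition primitive_roots_unity :: "nat \<Rightarrow> complex set" where
  "primitive_roots_unity n = {z. z ^ n = 1 \<and> (\<forall>m. 0 < m \<and> m < n \<longrightarrow> z ^ m \<noteq> 1)}"

text \<open>
  The product below has rational coefficients; \<open>of_rat_cyclotomic\<close> shows
  that the definite description is well-defined for every positive \<open>n\<close>.
\<close>
definition cyclotomic :: "nat \<Rightarrow> rat poly" where
  "cyclotomic n = (THE p. map_poly of_rat p = (\<Prod>z\<in>primitive_roots_unity n. [:- z, 1:]))"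

lemma map_poly_of_rat_mult:
  "map_poly of_rat (p * q) = (map_poly of_rat p * map_poly of_rat q :: 'a :: field_char_0 poly)"
  by (rule poly_eqI) (simp add: coeff_map_poly coeff_mult of_rat_sum of_rat_mult)

lemma map_poly_of_rat_add:
  "map_poly of_rat (p + q) = (map_poly of_rat p + map_poly of_rat q :: 'a :: field_char_0 poly)"
  by (rule poly_eqI) (simp add: coeff_map_poly of_rat_add)

lemma map_poly_of_rat_prod:
  "map_poly of_rat (\<Prod>x\<in>A. f x) = (\<Prod>x\<in>A. map_poly of_rat (f x) :: 'a :: field_char_0 poly)"
  by (induction A rule: infinite_finite_induct) (simp_all add: map_poly_of_rat_mult)

lemma map_poly_of_rat_inj:
  assumes "map_poly of_rat p = (map_poly of_rat q :: 'a :: field_char_0 poly)"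
  shows "p = q"
proof (rule poly_eqI)
  fix i
  have "of_rat (coeff p i) = (of_rat (coeff q i) :: 'a)"
    using arg_cong[OF assms, of "\<lambda>r. coeff r i"] by (simp add: coeff_map_poly)
  thus "coeff p i = coeff q i" by simp
qed

lemma roots_unity_eq_Union_primitive:
  assumes "n > 0"
  shows "{z::complex. z ^ n = 1} = (\<Union>d\<in>{d. d dvd n}. primitive_roots_unity d)"
proof (intro equalityI subsetI)
  fix z :: complex assume "z \<in> {z. z ^ n = 1}"
  hence z: "z ^ n = 1" by simp
  define d where "d = (LEAST d. d > 0 \<and> z ^ d = 1)"
  have d: "d > 0 \<and> z ^ d = 1" unfolding d_def by (rule LeastI[of _ n]) (use assms z in auto)
  have least: "z ^ m \<noteq> 1" if "0 < m" "m < d" for m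
    using not_less_Least[of m "\<lambda>d. d > 0 \<and> z ^ d = 1"] that by (auto simp: d_def)
  have "z ^ n = z ^ (d * (n div d) + n mod d)" by simp
  also have "\<dots> = z ^ (n mod d)" using d by (simp only: power_add power_mult) simp
  finally have "z ^ (n mod d) = 1" using z by simp
  hence "n mod d = 0" using least[of "n mod d"] d by (cases "n mod d = 0") auto
  thus "z \<in> (\<Union>d\<in>{d. d dvd n}. primitive_roots_unity d)"
    using d least by (auto simp: primitive_roots_unity_def)
next
  fix z :: complex assume "z \<in> (\<Union>d\<in>{d. d dvd n}. primitive_roots_unity d)"
  thus "z \<in> {z. z ^ n = 1}"
    by (auto simp: primitive_roots_unity_def power_mult elim!: dvdE)
qed

lemma prod_primitive_roots_unity:
  assumes "n > 0"
  shows "(\<Prod>d | d dvd n. \<Prod>z\<in>primitive_roots_unity d. [:- z, 1:]) = monom 1 n - 1"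
proof -
  have fin: "finite (primitive_roots_unity d)" if "d dvd n" for d
  proof -
    have "d > 0" using that assms by (auto intro: Nat.gr0I)
    thus ?thesis unfolding primitive_roots_unity_def
      by (intro finite_subset[OF _ finite_roots_unity[of d]]) auto
  qed
  have "(\<Prod>d | d dvd n. \<Prod>z\<in>primitive_roots_unity d. [:- z, 1:]) =
          (\<Prod>z\<in>(\<Union>d\<in>{d. d dvd n}. primitive_roots_unity d). [:- z, 1:])"
  proof (rule prod.UNION_disjoint[symmetric])
    show "finite {d. d dvd n}" using assms by simp
    show "\<forall>i\<in>{d. d dvd n}. finite (primitive_roots_unity i)" using fin by simp
    show "\<forall>i\<in>{d. d dvd n}. \<forall>j\<in>{d. d dvd n}. i \<noteq> j \<longrightarrow>
            primitive_roots_unity i \<inter> primitive_roots_unity j = {}"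
    proof (intro ballI impI)
      fix i j assume ij: "i \<in> {d. d dvd n}" "j \<in> {d. d dvd n}" "i \<noteq> j"
      have "i > 0" "j > 0" using ij assms by (auto intro: Nat.gr0I)
      thus "primitive_roots_unity i \<inter> primitive_roots_unity j = {}"
        using ij(3) by (auto simp: primitive_roots_unity_def dest: linorder_neq_iff[THEN iffD1])
    qed
  qed
  also have "\<dots> = (\<Prod>z | z ^ n = 1. [:- z, 1:])"
    by (simp add: roots_unity_eq_Union_primitive[OF assms])
  also have "\<dots> = monom 1 n - 1"
  proof (rule ccontr)
    define P where "P = (\<Prod>z | z ^ n = 1. [:- z :: complex, 1:])"
    define D where "D = P - (monom 1 n - 1)"
    assume "(\<Prod>z | z ^ n = 1. [:- z :: complex, 1:]) \<noteq> monom 1 n - 1"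
    hence "D \<noteq> 0" by (simp add: D_def P_def)
    have fin': "finite {z::complex. z ^ n = 1}" using assms by (intro finite_roots_unity) auto
    have card: "card {z::complex. z ^ n = 1} = n" using assms by (intro card_roots_unity_eq) auto
    have degP: "degree P = n" unfolding P_def by (subst degree_prod_eq_sum_degree) (auto simp: card)
    have lcP: "coeff P n = 1"
      using lead_coeff_prod[of "\<lambda>z::complex. [:- z, 1:]" "{z. z ^ n = 1}"] degP by (simp add: P_def)
    have "coeff D i = 0" if "i \<ge> n" for i
      using that lcP degP assms by (cases "i = n") (auto simp: D_def coeff_eq_0)
    hence "degree D < n" using \<open>D \<noteq> 0\<close> by (metis leading_coeff_0_iff not_le)
    moreover have "{z::complex. z ^ n = 1} \<subseteq> {z. poly D z = 0}"
      using fin' by (auto simp: D_def P_def poly_prod poly_monom)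
    hence "n \<le> card {z. poly D z = 0}"
      using card_mono[OF poly_roots_finite[OF \<open>D \<noteq> 0\<close>]] card by metis
    ultimately show False using card_poly_roots_bound[OF \<open>D \<noteq> 0\<close>] by simp
  qed
  finally show ?thesis .
qed

lemma of_rat_cyclotomic:
  assumes "n > 0"
  shows "map_poly of_rat (cyclotomic n) = (\<Prod>z\<in>primitive_roots_unity n. [:- z, 1:])"
proof -
  have "\<exists>p. map_poly of_rat p = (\<Prod>z\<in>primitive_roots_unity n. [:- z, 1:])" using assms
  proof (induction n rule: less_induct)
    case (less n)
    let ?C = "\<lambda>d. \<Prod>z\<in>primitive_roots_unity d. [:- z, 1:]"
    let ?h = "map_poly of_rat :: rat poly \<Rightarrow> complex poly"
    define A where "A = {d. d dvd n \<and> d \<noteq> n}"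
    have "\<forall>d\<in>A. \<exists>p. ?h p = ?C d"
      using less by (auto simp: A_def intro!: less.IH dest: dvd_imp_le intro: Nat.gr0I)
    then obtain f where f: "?h (f d) = ?C d" if "d \<in> A" for d by metis
    define P where "P = (\<Prod>d\<in>A. f d)"
    have hP: "?h P = (\<Prod>d\<in>A. ?C d)" by (simp add: P_def map_poly_of_rat_prod f)
    have nz: "?C d \<noteq> 0" for d
      by (cases "finite (primitive_roots_unity d)") auto
    have "?h P \<noteq> 0" unfolding hP
      by (cases "finite A") (use nz in auto)
    hence "P \<noteq> 0" by auto
    define X where "X = (monom 1 n - 1 :: rat poly)"
    have hX: "?h X = monom 1 n - 1"
      by (rule poly_eqI) (auto simp: X_def coeff_map_poly)
    have "{d. d dvd n} = insert n A" by (auto simp: A_def)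
    moreover have "finite A" "n \<notin> A" using less.prems by (auto simp: A_def)
    ultimately have split: "?h X = ?C n * ?h P"
      using prod_primitive_roots_unity[OF less.prems] by (simp add: hX hP)
    have "?h X = ?h (X div P) * ?h P + ?h (X mod P)"
      by (metis div_mult_mod_eq map_poly_of_rat_add map_poly_of_rat_mult)
    hence eq: "?h (X mod P) = (?C n - ?h (X div P)) * ?h P"
      using split by (simp add: algebra_simps)
    have deg: "degree (?h p) = degree p" for p by (rule degree_map_poly) auto
    have "?C n - ?h (X div P) = 0"
    proof (rule ccontr)
      assume *: "?C n - ?h (X div P) \<noteq> 0"
      hence "?h (X mod P) \<noteq> 0" using eq \<open>?h P \<noteq> 0\<close> by simp
      hence "X mod P \<noteq> 0" by auto
      hence "degree (X mod P) < degree P" using degree_mod_less[OF \<open>P \<noteq> 0\<close>, of X] by simp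
      moreover have "degree (?h (X mod P)) \<ge> degree (?h P)"
        unfolding eq using * \<open>?h P \<noteq> 0\<close> by (simp add: degree_mult_eq)
      ultimately show False by (simp add: deg)
    qed
    thus ?case by (intro exI[of _ "X div P"]) simp
  qed
  then obtain p where p: "map_poly of_rat p = (\<Prod>z\<in>primitive_roots_unity n. [:- z, 1:])" ..
  show ?thesis unfolding cyclotomic_def
    by (rule theI[of _ p]) (auto simp: p intro: map_poly_of_rat_inj[where 'a = complex])
qed

section \<open>Congruences between rational functions\<close>

definition qvar :: "rat poly fract" where
  "qvar = to_fract [:0, 1:]"

text \<open>
  The ring of Laurent polynomials in \<open>q\<close> with rational coefficients, as a subring of the
  field of rational functions. Divisibility and coprimality are those of this subring
  (in the whole field, both would be trivial).
\<close>
definition laurent_polys :: "rat poly fract set" where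
  "laurent_polys = {to_fract p / qvar ^ m | p m. True}"

definition laurent_dvd :: "rat poly fract \<Rightarrow> rat poly fract \<Rightarrow> bool" where
  "laurent_dvd A B \<longleftrightarrow> (\<exists>C\<in>laurent_polys. B = A * C)"

definition laurent_coprime :: "rat poly fract \<Rightarrow> rat poly fract \<Rightarrow> bool" where
  "laurent_coprime A B \<longleftrightarrow>
     (\<forall>D\<in>laurent_polys. laurent_dvd D A \<longrightarrow> laurent_dvd D B \<longrightarrow> laurent_dvd D 1)"

definition ratfun_cong :: "rat poly fract \<Rightarrow> rat poly fract \<Rightarrow> rat poly \<Rightarrow> bool" where
  "ratfun_cong R S P \<longleftrightarrow>
     (\<exists>A\<in>laurent_polys. \<exists>B\<in>laurent_polys. B \<noteq> 0 \<and> R - S = A / B \<and>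
        laurent_coprime B (to_fract P) \<and> laurent_dvd (to_fract P) A)"

end

theory Submission
  imports Defs "HOL-Computational_Algebra.Field_as_Ring"
begin

text \<open>
  Write \<open>p = q\<^sup>9\<close>, \<open>a = q\<close> to the power \<open>-r\<close> and \<open>B = q\<close> to the power \<open>-s\<close>, where \<open>2r + s = 9\<close>. If
  \<open>9 | mn + r\<close> and \<open>u\<close> is the \<open>mn\<close>-th power of \<open>q\<close>, then \<open>(a)\<^sub>k\<^sup>2\<close> and \<open>(a/u)\<^sub>k (au)\<^sub>k\<close>
  agree modulo \<open>(1 - u)\<^sup>2\<close>, hence modulo the square of the cyclotomic polynomial, and the
  sum with the latter product terminates: \<open>a/u\<close> is the power \<open>-M\<close> of \<open>p\<close> with \<open>9M = mn + r\<close>.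
  With \<open>A = au\<close>, the product \<open>A B\<close> is the power \<open>M - 1\<close> of \<open>p\<close>. For such \<open>A\<close> and \<open>B\<close> the terminating
  \<open>\<^sub>3\<phi>\<^sub>2\<close> series contains the square of \<open>(p/B; p)\<close> with \<open>M - 2\<close> factors: one application of the
  \<open>q\<close>-Chu--Vandermonde sum extracts the first copy and leaves a linear combination of
  summable \<open>\<^sub>2\<phi>\<^sub>1\<close> series that contain the second. One of these factors is
  \<open>1 - q\<close> to a power that is a multiple of \<open>n\<close>, so it vanishes modulo the cyclotomic polynomial.
\<close>

section \<open>Terminating basic hypergeometric sums\<close>

text \<open>The \<open>q\<close>-Pascal recursion avoids quotients, so identities proved by
  induction on it hold in every commutative ring, even at roots of unity.\<close>

fun qbinomial :: "'a :: comm_ring_1 \<Rightarrow> nat \<Rightarrow> nat \<Rightarrow> 'a" where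
  "qbinomial q n 0 = 1"
| "qbinomial q 0 (Suc k) = 0"
| "qbinomial q (Suc n) (Suc k) = q ^ Suc k * qbinomial q n (Suc k) + qbinomial q n k"

text \<open>Homogeneous form of the shifted factorial: \<open>x^n (c/x; q)_n\<close> when
  \<open>x\<close> is invertible.\<close>

definition qfactors :: "'a :: comm_ring_1 \<Rightarrow> 'a \<Rightarrow> 'a \<Rightarrow> nat \<Rightarrow> 'a" where
  "qfactors x c q n = (\<Prod>i<n. x - c * q ^ i)"

lemma qpochhammer_0 [simp]: "qpochhammer a q 0 = 1"
  by (simp add: qpochhammer_def)

lemma qpochhammer_Suc: "qpochhammer a q (Suc n) = qpochhammer a q n * (1 - a * q ^ n)"
  by (simp add: qpochhammer_def)

lemma qpochhammer_add:
  "qpochhammer a q (m + n) = qpochhammer a q m * qpochhammer (a * q ^ m) q n"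
  by (induction n) (simp_all add: qpochhammer_Suc power_add algebra_simps)

lemma qpochhammer_rec: "qpochhammer a q (Suc n) = (1 - a) * qpochhammer (a * q) q n"
  using qpochhammer_add[of a q 1 n] by (simp add: qpochhammer_Suc)

lemma qpochhammer_split:
  assumes "k \<le> n"
  shows "qpochhammer q q n = qpochhammer q q k * qpochhammer (q ^ Suc k) q (n - k)"
  using qpochhammer_add[of q q k "n - k"] assms by simp

lemma qfactors_0 [simp]: "qfactors x c q 0 = 1"
  by (simp add: qfactors_def)

lemma qfactors_Suc: "qfactors x c q (Suc n) = qfactors x c q n * (x - c * q ^ n)"
  by (simp add: qfactors_def)

lemma qfactors_scale: "qfactors (t * x) (t * c) q n = t ^ n * qfactors x c q n"
  by (induction n) (simp_all add: qfactors_Suc algebra_simps)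

lemma qbinomial_eq_0 [simp]: "n < k \<Longrightarrow> qbinomial q n k = 0"
  by (induction q n k rule: qbinomial.induct) auto

lemma qbinomial_qpochhammer:
  "k \<le> n \<Longrightarrow> qbinomial q n k * qpochhammer q q k * qpochhammer q q (n - k) = qpochhammer q q n"
proof (induction q n k rule: qbinomial.induct)
  case (3 q n k)
  show ?case
  proof (cases "k = n")
    case True
    then show ?thesis using 3 by (simp add: qpochhammer_Suc flip: mult.assoc)
  next
    case False
    then obtain d where d: "n = Suc k + d"
      using 3 by (metis Suc_leI Suc_le_mono le_Suc_ex le_neq_implies_less)
    \<comment> \<open>The two Pascal terms carry the weights \<open>q^(k+1) (1 - q^(n-k))\<close>
      and \<open>1 - q^(k+1)\<close>, which add up to \<open>1 - q^(n+1)\<close>.\<close>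
    have "qbinomial q (Suc n) (Suc k) * qpochhammer q q (Suc k) * qpochhammer q q (Suc n - Suc k)
       = q ^ Suc k * (1 - q ^ Suc d) * (qbinomial q n (Suc k) * qpochhammer q q (Suc k) * qpochhammer q q (n - Suc k))
         + (1 - q ^ Suc k) * (qbinomial q n k * qpochhammer q q k * qpochhammer q q (n - k))"
      by (simp add: d qpochhammer_Suc algebra_simps)
    also have "\<dots> = (q ^ Suc k * (1 - q ^ Suc d) + (1 - q ^ Suc k)) * qpochhammer q q n"
      using 3 False by (simp add: algebra_simps)
    also have "\<dots> = qpochhammer q q (Suc n)"
      by (simp add: d qpochhammer_Suc power_add algebra_simps)
    finally show ?thesis .
  qed
qed auto

text \<open>Reduces the induction step for a \<open>q\<close>-binomial sum to an identity between
  single summands.\<close>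

lemma sum_qbinomial_Suc:
  "(\<Sum>l\<le>Suc n. qbinomial q (Suc n) l * g l) =
   (\<Sum>l\<le>n. qbinomial q n l * (q ^ l * g l + g (Suc l)))"
proof -
  have "(\<Sum>l\<le>n. qbinomial q n l * (q ^ l * g l)) = (\<Sum>l\<le>Suc n. qbinomial q n l * (q ^ l * g l))"
    by simp
  also have "\<dots> = g 0 + (\<Sum>l\<le>n. qbinomial q n (Suc l) * (q ^ Suc l * g (Suc l)))"
    by (subst sum.atMost_Suc_shift) simp
  finally show ?thesis
    by (subst sum.atMost_Suc_shift) (simp add: sum.distrib algebra_simps)
qed

section \<open>The \<open>q\<close>-Chu-Vandermonde sums\<close>

lemma choose_two_Suc: "Suc n choose 2 = (n choose 2) + n"
  by (simp add: numeral_2_eq_2)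

lemma choose_two_add: "(m + n) choose 2 = (m choose 2) + (n choose 2) + m * n"
  by (induction n) (simp_all add: choose_two_Suc)

text \<open>
  The two \<open>q\<close>-Chu--Vandermonde sums, cleared of denominators so that they hold in any
  commutative ring.
\<close>
lemma q_vandermonde:
  "(\<Sum>l\<le>n. qbinomial q n l *
      ((-1) ^ l * q ^ (l choose 2) * qfactors x c q l * qpochhammer (c * q ^ l) q (n - l))) =
   qpochhammer x q n"
proof (induction n arbitrary: x c)
  case (Suc n)
  let ?g = "\<lambda>x c l. (-1) ^ l * q ^ (l choose 2) * qfactors x c q l * qpochhammer (c * q ^ l) q (n - l)"
  \<comment> \<open>The two Pascal contributions merge into one summand with parameters
    \<open>q * x\<close> and \<open>q * c\<close>; hence the induction over all \<open>x\<close> and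
    \<open>c\<close>.\<close>
  have "q ^ l * ((-1) ^ l * q ^ (l choose 2) * qfactors x c q l * qpochhammer (c * q ^ l) q (Suc n - l))
      + (-1) ^ Suc l * q ^ (Suc l choose 2) * qfactors x c q (Suc l) * qpochhammer (c * q ^ Suc l) q (Suc n - Suc l)
      = (1 - x) * ?g (q * x) (q * c) l" if "l \<le> n" for l
  proof -
    obtain d where d: "n = l + d" using \<open>l \<le> n\<close> le_Suc_ex by blast
    show ?thesis
      unfolding qfactors_scale
      by (simp add: d qpochhammer_rec qfactors_Suc choose_two_Suc power_add algebra_simps)
  qed
  then have "(\<Sum>l\<le>Suc n. qbinomial q (Suc n) l *
      ((-1) ^ l * q ^ (l choose 2) * qfactors x c q l * qpochhammer (c * q ^ l) q (Suc n - l)))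
    = (\<Sum>l\<le>n. qbinomial q n l * ((1 - x) * ?g (q * x) (q * c) l))"
    unfolding sum_qbinomial_Suc by (intro sum.cong refl) (metis atMost_iff)
  also have "\<dots> = (1 - x) * (\<Sum>l\<le>n. qbinomial q n l * ?g (q * x) (q * c) l)"
    by (simp add: sum_distrib_left algebra_simps)
  also have "\<dots> = qpochhammer x q (Suc n)"
    by (simp only: Suc.IH) (simp add: qpochhammer_rec mult.commute)
  finally show ?case .
qed (simp add: binomial_eq_0)

lemma q_vandermonde_reversed:
  "(\<Sum>l\<le>n. qbinomial q n l *
      ((-1) ^ l * q ^ ((n - l) choose 2) * qpochhammer b q l * qpochhammer (c * q ^ l) q (n - l))) =
   q ^ (n choose 2) * qfactors b c q n"
proof (induction n arbitrary: b c)
  case (Suc n)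
  let ?g = "\<lambda>b c l. (-1) ^ l * q ^ ((n - l) choose 2) * qpochhammer b q l * qpochhammer (c * q ^ l) q (n - l)"
  \<comment> \<open>Here the merger leaves two summands, one with \<open>b\<close>, \<open>c\<close>
    unchanged and one with both multiplied by \<open>q\<close>. After summation the coefficients
    combine as \<open>(1 - c q^n) - (1 - b) = b - c q^n\<close>, the next factor of the
    product.\<close>
  have "q ^ l * ((-1) ^ l * q ^ ((Suc n - l) choose 2) * qpochhammer b q l * qpochhammer (c * q ^ l) q (Suc n - l))
      + (-1) ^ Suc l * q ^ ((Suc n - Suc l) choose 2) * qpochhammer b q (Suc l) * qpochhammer (c * q ^ Suc l) q (Suc n - Suc l)
      = q ^ n * (1 - c * q ^ n) * ?g b c l - (1 - b) * ?g (q * b) (q * c) l" if "l \<le> n" for l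
  proof -
    obtain d where d: "n = l + d" using \<open>l \<le> n\<close> le_Suc_ex by blast
    have 1: "qpochhammer (c * q ^ l) q (Suc d) = qpochhammer (c * q ^ l) q d * (1 - c * q ^ n)"
      by (simp add: qpochhammer_Suc d power_add algebra_simps)
    have 2: "qpochhammer b q (Suc l) = (1 - b) * qpochhammer (q * b) q l"
      by (simp add: qpochhammer_rec mult.commute)
    have 3: "Suc n - l = Suc d" "Suc n - Suc l = d" "n - l = d" by (auto simp: d)
    show ?thesis
      unfolding 1 2 3
      by (simp add: d choose_two_Suc power_add algebra_simps)
  qed
  then have "(\<Sum>l\<le>Suc n. qbinomial q (Suc n) l *
      ((-1) ^ l * q ^ ((Suc n - l) choose 2) * qpochhammer b q l * qpochhammer (c * q ^ l) q (Suc n - l)))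
    = (\<Sum>l\<le>n. qbinomial q n l * (q ^ n * (1 - c * q ^ n) * ?g b c l - (1 - b) * ?g (q * b) (q * c) l))"
    unfolding sum_qbinomial_Suc by (intro sum.cong refl) (metis atMost_iff)
  also have "\<dots> = q ^ n * (1 - c * q ^ n) * (\<Sum>l\<le>n. qbinomial q n l * ?g b c l)
      - (1 - b) * (\<Sum>l\<le>n. qbinomial q n l * ?g (q * b) (q * c) l)"
    by (simp add: sum_distrib_left sum_subtractf right_diff_distrib mult.left_commute)
  also have "\<dots> = q ^ (Suc n choose 2) * qfactors b c q (Suc n)"
    by (simp only: Suc.IH qfactors_scale)
       (simp add: qfactors_Suc choose_two_Suc power_add algebra_simps)
  finally show ?case .
qed (simp add: binomial_eq_0)

section \<open>Transformation of a terminating series\<close>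

lemma qpochhammer_nonzero:
  fixes q :: "'a :: field"
  assumes "\<And>i. 0 < i \<Longrightarrow> i \<le> n \<Longrightarrow> q ^ i \<noteq> 1"
  shows "qpochhammer q q n \<noteq> 0"
  using assms[of "Suc _"] by (auto simp: qpochhammer_def)

text \<open>Both sides are the \<open>q\<close>-multinomial coefficient with parts \<open>j\<close>,
  \<open>l\<close> and \<open>n - j - l\<close>.\<close>

lemma qbinomial_mult:
  fixes q :: "'a :: field"
  assumes "\<And>i. 0 < i \<Longrightarrow> i \<le> n \<Longrightarrow> q ^ i \<noteq> 1" and "j + l \<le> n"
  shows "qbinomial q n (j + l) * qbinomial q (j + l) j = qbinomial q n j * qbinomial q (n - j) l"
proof -
  have nz: "qpochhammer q q m \<noteq> 0" if "m \<le> n" for m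
    using that assms(1) by (intro qpochhammer_nonzero) auto
  have *: "qbinomial q m k = qpochhammer q q m / (qpochhammer q q k * qpochhammer q q (m - k))"
    if "k \<le> m" "m \<le> n" for m k
    using that nz[of k] nz[of "m - k"] qbinomial_qpochhammer[of k m q]
    by (simp add: eq_divide_eq mult_ac)
  show ?thesis
    using assms(2) nz by (simp add: *)
qed

text \<open>The factors are reversed by \<open>1 - q^(i-n) = - q^(i-n) (1 - q^(n-i))\<close>;
  multiplying through by \<open>q^(n choose 2)\<close> avoids negative exponents.\<close>

lemma qpochhammer_inverse_power:
  fixes q :: "'a :: field"
  assumes "q \<noteq> 0"
  shows "k \<le> n \<Longrightarrow> q ^ (n choose 2) * qpochhammer (1 / q ^ n) q k * q ^ k * qpochhammer q q (n - k) =
    (-1) ^ k * q ^ ((n - k) choose 2) * qpochhammer q q n"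
proof (induction k)
  case (Suc k)
  then obtain d where d: "n = Suc k + d" by (metis le_Suc_ex)
  have 1: "n - k = Suc d" "n - Suc k = d" by (simp_all add: d)
  have 2: "q * (1 - 1 / q ^ n * q ^ k) * q ^ d = - (1 - q ^ Suc d)"
    using assms by (simp add: d power_add field_simps)
  \<comment> \<open>The extra \<open>q ^ d\<close> accounts for the step from
    \<open>d choose 2\<close> to \<open>Suc d choose 2\<close>, which lets the induction hypothesis
    apply; it is cancelled at the end.\<close>
  have "q ^ (n choose 2) * qpochhammer (1 / q ^ n) q (Suc k) * q ^ Suc k * qpochhammer q q d * q ^ d
    = - (q ^ (n choose 2) * qpochhammer (1 / q ^ n) q k * q ^ k * (qpochhammer q q d * (1 - q ^ Suc d)))"
    (is "?L = - ?R")
  proof -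
    have "?L = q ^ (n choose 2) * qpochhammer (1 / q ^ n) q k * q ^ k * qpochhammer q q d *
        (q * (1 - 1 / q ^ n * q ^ k) * q ^ d)"
      by (simp only: qpochhammer_Suc power_Suc mult_ac)
    then show ?thesis
      by (simp only: 2) (simp only: mult_minus_right mult_minus_left mult_ac)
  qed
  also have "\<dots> = - (q ^ (n choose 2) * qpochhammer (1 / q ^ n) q k * q ^ k * qpochhammer q q (n - k))"
    by (simp add: 1 qpochhammer_Suc)
  also have "\<dots> = (-1) ^ Suc k * q ^ (d choose 2) * qpochhammer q q n * q ^ d"
    using Suc by (simp add: 1 choose_two_Suc power_add)
  finally show ?case
    using assms unfolding 1 by (simp only: mult_cancel_right power_eq_0_iff) simp
qed simp

text \<open>Supplies the sign and the power of \<open>q\<close> that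
  \<open>q_vandermonde_reversed\<close> requires.\<close>

lemma qpochhammer_inverse_power_ratio:
  fixes q :: "'a :: field"
  assumes "q \<noteq> 0" "\<And>i. 0 < i \<Longrightarrow> i \<le> n \<Longrightarrow> q ^ i \<noteq> 1" "k \<le> n"
  shows "q ^ (n choose 2) * (qpochhammer (1 / q ^ n) q k * q ^ k / qpochhammer q q k) =
    (-1) ^ k * q ^ ((n - k) choose 2) * qbinomial q n k"
proof -
  have nz: "qpochhammer q q m \<noteq> 0" if "m \<le> n" for m
    using that assms(2) by (intro qpochhammer_nonzero) auto
  have "q ^ (n choose 2) * qpochhammer (1 / q ^ n) q k * q ^ k * qpochhammer q q (n - k) =
      (-1) ^ k * q ^ ((n - k) choose 2) * qbinomial q n k * qpochhammer q q k * qpochhammer q q (n - k)"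
    using qbinomial_qpochhammer[OF assms(3), of q]
    by (simp only: qpochhammer_inverse_power[OF assms(1,3)]) (simp add: mult_ac)
  then have "q ^ (n choose 2) * qpochhammer (1 / q ^ n) q k * q ^ k =
      (-1) ^ k * q ^ ((n - k) choose 2) * qbinomial q n k * qpochhammer q q k"
    using nz[of "n - k"] by simp
  then show ?thesis
    using nz[OF assms(3)] by (simp add: divide_eq_eq mult.assoc)
qed

lemma sum_triangle:
  fixes f :: "nat \<Rightarrow> nat \<Rightarrow> 'a :: comm_monoid_add"
  shows "(\<Sum>k\<le>n. \<Sum>j\<le>k. f j (k - j)) = (\<Sum>j\<le>n. \<Sum>l\<le>n - j. f j l)"
proof -
  have "{(j, l). j + l \<le> n} = (SIGMA j:{..n}. {..n - j})" by auto
  then show ?thesis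
    unfolding sum.triangle_reindex_eq[symmetric] by (simp add: sum.Sigma)
qed

text \<open>
  Expanding \<open>(A)\<^sub>k / (q)\<^sub>k\<close> by the first \<open>q\<close>-Chu--Vandermonde sum and interchanging the sums makes the inner sum an
  instance of the reversed form.
\<close>
lemma q_sheppard:
  fixes q A B :: "'a :: field"
  assumes "q \<noteq> 0" and root: "\<And>i. 0 < i \<Longrightarrow> i \<le> n \<Longrightarrow> q ^ i \<noteq> 1"
  shows "qpochhammer q q n *
      (\<Sum>k\<le>n. qpochhammer (1 / q ^ n) q k * qpochhammer A q k * qpochhammer B q k * q ^ k /
        qpochhammer q q k ^ 3) =
    (\<Sum>j\<le>n. qbinomial q n j * qpochhammer B q j * qfactors A q q j * qfactors B q q (n - j) /
        qpochhammer q q j)"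
    (is "?P * ?S = ?R")
proof -
  have nz: "qpochhammer q q m \<noteq> 0" if "m \<le> n" for m
    using that root by (intro qpochhammer_nonzero) auto
  \<comment> \<open>This is \<open>q_vandermonde\<close> with \<open>c = q\<close>: dividing by
    \<open>(q; q)_k\<close> turns \<open>(q^(j+1); q)_(k-j)\<close> into
    \<open>1 / (q; q)_j\<close>.\<close>
  have A: "qpochhammer A q k / qpochhammer q q k =
      (\<Sum>j\<le>k. qbinomial q k j * ((-1) ^ j * q ^ (j choose 2) * qfactors A q q j / qpochhammer q q j))"
    if "k \<le> n" for k
  proof -
    have "qpochhammer (q ^ Suc j) q (k - j) / qpochhammer q q k = 1 / qpochhammer q q j" if "j \<le> k" for j
      using qpochhammer_split[OF that, of q] nz[OF \<open>k \<le> n\<close>] nz[of j] \<open>j \<le> k\<close> \<open>k \<le> n\<close>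
      by (simp add: field_simps)
    then have "qbinomial q k j * (x * qpochhammer (q * q ^ j) q (k - j)) / qpochhammer q q k =
        qbinomial q k j * (x / qpochhammer q q j)" if "j \<le> k" for j x
      using that by (metis (no_types, lifting) mult.right_neutral power_Suc times_divide_eq_right)
    then show ?thesis
      unfolding q_vandermonde[symmetric, of A q k q] sum_divide_distrib
      by (intro sum.cong refl) simp
  qed
  \<comment> \<open>Contribution of the index pair \<open>k = j + l\<close>, \<open>j\<close>. The
    last bracket is the summand of \<open>q_vandermonde_reversed\<close> of length
    \<open>n - j\<close> at \<open>b = B q^j\<close>, \<open>c = q^(j+1)\<close>.\<close>
  define g where "g = (\<lambda>j l. q ^ (j choose 2) * qbinomial q n j * qpochhammer B q j *
      qfactors A q q j / qpochhammer q q j *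
      (qbinomial q (n - j) l * ((-1) ^ l * q ^ ((n - j - l) choose 2) *
        qpochhammer (B * q ^ j) q l * qpochhammer (q ^ Suc j * q ^ l) q (n - j - l))))"
  have g: "?P * ((-1) ^ k * q ^ ((n - k) choose 2) * qbinomial q n k * qpochhammer B q k / qpochhammer q q k *
      (qbinomial q k j * ((-1) ^ j * q ^ (j choose 2) * qfactors A q q j / qpochhammer q q j))) = g j (k - j)"
    if "j \<le> k" "k \<le> n" for j k
  proof -
    obtain l where l: "k = j + l" using \<open>j \<le> k\<close> le_Suc_ex by blast
    have 1: "?P / qpochhammer q q k = qpochhammer (q ^ Suc k) q (n - k)"
      using qpochhammer_split[OF \<open>k \<le> n\<close>, of q] nz[OF \<open>k \<le> n\<close>] by (simp add: field_simps)
    have 2: "qbinomial q n k * qbinomial q k j = qbinomial q n j * qbinomial q (n - j) l"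
      unfolding l using qbinomial_mult[OF root] \<open>k \<le> n\<close> l by simp
    have 3: "(-1) ^ k * (-1) ^ j = (-1 :: 'a) ^ l"
      by (simp add: l power_add flip: power_mult_distrib)
    have 4: "qpochhammer B q k = qpochhammer B q j * qpochhammer (B * q ^ j) q l"
      by (simp add: l qpochhammer_add)
    have "?P * ((-1) ^ k * q ^ ((n - k) choose 2) * qbinomial q n k * qpochhammer B q k / qpochhammer q q k *
      (qbinomial q k j * ((-1) ^ j * q ^ (j choose 2) * qfactors A q q j / qpochhammer q q j)))
      = (?P / qpochhammer q q k) * (qbinomial q n k * qbinomial q k j) * ((-1) ^ k * (-1) ^ j) *
        q ^ ((n - k) choose 2) * qpochhammer B q k * q ^ (j choose 2) * qfactors A q q j / qpochhammer q q j"
      by (simp add: mult_ac)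
    also have "\<dots> = g j (k - j)"
      unfolding 1 2 3 4 g_def by (simp add: l power_add mult_ac)
    finally show ?thesis .
  qed
  have inner: "(\<Sum>l\<le>n - j. g j l) = q ^ (n choose 2) *
      (qbinomial q n j * qpochhammer B q j * qfactors A q q j * qfactors B q q (n - j) / qpochhammer q q j)"
    if "j \<le> n" for j
  proof -
    \<comment> \<open>The common factor \<open>q ^ j\<close> of both parameters yields
      \<open>q^(j (n-j))\<close>, exactly what completes the exponent to
      \<open>n choose 2\<close>.\<close>
    have "qfactors (B * q ^ j) (q ^ Suc j) q (n - j) = q ^ (j * (n - j)) * qfactors B q q (n - j)"
      using qfactors_scale[of "q ^ j" B q q "n - j"] by (simp add: mult.commute power_mult)
    moreover have "q ^ (n choose 2) = q ^ (j choose 2) * q ^ ((n - j) choose 2) * q ^ (j * (n - j))"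
      using choose_two_add[of j "n - j"] that by (simp flip: power_add)
    ultimately show ?thesis
      unfolding g_def sum_distrib_left[symmetric] q_vandermonde_reversed by (simp add: mult_ac)
  qed
  have "q ^ (n choose 2) * (?P * ?S) = (\<Sum>k\<le>n. ?P *
      (q ^ (n choose 2) * (qpochhammer (1 / q ^ n) q k * q ^ k / qpochhammer q q k) *
       qpochhammer B q k / qpochhammer q q k * (qpochhammer A q k / qpochhammer q q k)))"
    unfolding sum_distrib_left by (intro sum.cong refl) (simp add: power3_eq_cube mult_ac)
  also have "\<dots> = (\<Sum>k\<le>n. \<Sum>j\<le>k. g j (k - j))"
  proof (intro sum.cong refl)
    fix k assume "k \<in> {..n}"
    then have k: "k \<le> n" by simp
    have "?P * (q ^ (n choose 2) * (qpochhammer (1 / q ^ n) q k * q ^ k / qpochhammer q q k) *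
        qpochhammer B q k / qpochhammer q q k * (qpochhammer A q k / qpochhammer q q k)) =
      ?P * ((-1) ^ k * q ^ ((n - k) choose 2) * qbinomial q n k * qpochhammer B q k / qpochhammer q q k *
        (\<Sum>j\<le>k. qbinomial q k j * ((-1) ^ j * q ^ (j choose 2) * qfactors A q q j / qpochhammer q q j)))"
      by (simp only: qpochhammer_inverse_power_ratio[OF assms(1) root k] A[OF k])
    also have "\<dots> = (\<Sum>j\<le>k. g j (k - j))"
      unfolding sum_distrib_left by (intro sum.cong refl g k) simp
    finally show "?P * (q ^ (n choose 2) * (qpochhammer (1 / q ^ n) q k * q ^ k / qpochhammer q q k) *
        qpochhammer B q k / qpochhammer q q k * (qpochhammer A q k / qpochhammer q q k)) =
        (\<Sum>j\<le>k. g j (k - j))" .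
  qed
  also have "\<dots> = q ^ (n choose 2) * ?R"
    unfolding sum_triangle sum_distrib_left by (intro sum.cong refl inner) simp
  finally show ?thesis using assms(1) by simp
qed

section \<open>Weighted Vandermonde sums and the double factor\<close>

lemma qfactors_weight:
  fixes q :: "'a :: comm_ring_1"
  shows "i \<le> j \<Longrightarrow> j \<le> n \<Longrightarrow> (\<Prod>t<i. q ^ (n - t) - q ^ (n - j)) * qpochhammer q q (j - i) =
    (-1) ^ i * q ^ (i * (n - j)) * qpochhammer q q j"
proof (induction i)
  case (Suc i)
  then obtain d where d: "j = Suc i + d" by (metis le_Suc_ex)
  have 1: "j - i = Suc d" "j - Suc i = d" by (simp_all add: d)
  have "n - i = n - j + Suc d" using Suc.prems by (simp add: d)
  then have "q ^ (n - i) = q ^ (n - j) * q ^ Suc d" by (simp only: power_add)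
  \<comment> \<open>Up to sign and a power of \<open>q\<close>, the new factor extends
    \<open>(q; q)_(j-i-1)\<close> to \<open>(q; q)_(j-i)\<close>. A weight with \<open>i\<close>
    factors thus trades \<open>(q; q)_j\<close> for \<open>(q; q)_(j-i)\<close>.\<close>
  then have 2: "q ^ (n - i) - q ^ (n - j) = - (q ^ (n - j)) * (1 - q ^ Suc d)"
    by (simp add: algebra_simps)
  have "(\<Prod>t<Suc i. q ^ (n - t) - q ^ (n - j)) * qpochhammer q q d
    = - (q ^ (n - j)) * ((\<Prod>t<i. q ^ (n - t) - q ^ (n - j)) * (qpochhammer q q d * (1 - q ^ Suc d)))"
    by (simp only: prod.lessThan_Suc 2 mult_ac)
  also have "\<dots> = - (q ^ (n - j)) * ((-1) ^ i * q ^ (i * (n - j)) * qpochhammer q q j)"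
    using Suc by (simp add: 1 qpochhammer_Suc)
  finally show ?case by (simp add: 1 power_add mult_ac)
qed simp

text \<open>The weight is a Newton basis polynomial in \<open>q^(n-j)\<close>. It removes the terms
  with \<open>j < i\<close>, and what remains is \<open>q_vandermonde\<close> of length
  \<open>n - i\<close> at \<open>x = q / B\<close>, \<open>c = q^(i+1)\<close>.\<close>

lemma q_vandermonde_weighted:
  fixes q B :: "'a :: field"
  assumes "B \<noteq> 0" and root: "\<And>i. 0 < i \<Longrightarrow> i \<le> n \<Longrightarrow> q ^ i \<noteq> 1" and "i \<le> n"
  shows "(\<Sum>j\<le>n. qbinomial q n j * ((-1) ^ j * q ^ (j choose 2) * qpochhammer B q j * (q / B) ^ j *
      (\<Prod>t<i. q ^ (n - t) - q ^ (n - j)) / qpochhammer q q j)) =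
    q ^ (i choose 2) * q ^ (i * (n - i)) * qpochhammer B q i * (q / B) ^ i *
      qpochhammer (q / B) q (n - i) / qpochhammer q q (n - i)"
    (is "(\<Sum>j\<le>n. ?f j) = ?R")
proof -
  have nz: "qpochhammer q q m \<noteq> 0" if "m \<le> n" for m
    using that root by (intro qpochhammer_nonzero) auto
  let ?c = "q ^ (i choose 2) * q ^ (i * (n - i)) * qpochhammer B q i * (q / B) ^ i / qpochhammer q q (n - i)"
  let ?b = "B * q ^ i" and ?x = "q / B"
  have zero: "?f j = 0" if "j < i" for j
  proof -
    have "(\<Prod>t<i. q ^ (n - t) - q ^ (n - j)) = 0" using that by auto
    then show ?thesis by simp
  qed
  have "(\<Sum>j\<le>n. ?f j) = (\<Sum>j=i..n. ?f j)"
    using zero by (intro sum.mono_neutral_right) auto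
  also have "\<dots> = (\<Sum>l=0..n - i. ?f (i + l))"
    using assms(3) by (subst sum.atLeastAtMost_shift_0) auto
  also have "\<dots> = (\<Sum>l\<le>n - i. ?c * (qbinomial q (n - i) l * ((-1) ^ l * q ^ (l choose 2) *
      qfactors ?x (q ^ Suc i) q l * qpochhammer (q ^ Suc i * q ^ l) q (n - i - l))))"
  proof (intro sum.cong)
    fix l assume "l \<in> {..n - i}"
    then have l: "i + l \<le> n" using assms(3) by auto
    have 1: "(\<Prod>t<i. q ^ (n - t) - q ^ (n - (i + l))) / qpochhammer q q (i + l) =
        (-1) ^ i * q ^ (i * (n - (i + l))) / qpochhammer q q l"
      using qfactors_weight[of i "i + l" n q] l nz[of l] nz[of "i + l"] by (simp add: field_simps)
    have 2: "qbinomial q n (i + l) = qbinomial q (n - i) l *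
        (qpochhammer q q l * qpochhammer (q ^ Suc i * q ^ l) q (n - i - l)) / qpochhammer q q (n - i)"
    proof -
      have "qbinomial q (n - i) l * qpochhammer q q l * qpochhammer q q (n - (i + l)) = qpochhammer q q (n - i)"
        using qbinomial_qpochhammer[of l "n - i" q] l by simp
      moreover have "qbinomial q n (i + l) * qpochhammer q q (n - (i + l)) = qpochhammer (q ^ Suc i * q ^ l) q (n - i - l)"
      proof -
        have "qbinomial q n (i + l) * qpochhammer q q (n - (i + l)) * qpochhammer q q (i + l)
          = qpochhammer (q ^ Suc i * q ^ l) q (n - i - l) * qpochhammer q q (i + l)"
          using qbinomial_qpochhammer[OF l, of q] qpochhammer_split[OF l, of q]
          by (simp add: power_add mult_ac)
        then show ?thesis using nz[OF l] by simp
      qed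
      ultimately have "qbinomial q (n - i) l * (qpochhammer q q l * qpochhammer (q ^ Suc i * q ^ l) q (n - i - l))
          = qbinomial q n (i + l) * qpochhammer q q (n - i)"
        by (metis (no_types) mult.assoc mult.left_commute)
      then show ?thesis using nz[of "n - i"] by simp
    qed
    \<comment> \<open>Spreading the powers of \<open>q / B\<close> over the factors turns
      \<open>1 - B q^(i+t)\<close> into \<open>q / B - q^(i+t+1)\<close>.\<close>
    have 3: "qpochhammer B q (i + l) * (q / B) ^ (i + l) =
        qpochhammer B q i * (q / B) ^ i * qfactors ?x (q ^ Suc i) q l"
    proof -
      have "qfactors ?x (q ^ Suc i) q l = ?x ^ l * qpochhammer ?b q l"
        using qfactors_scale[of ?x 1 ?b q l] assms(1) by (simp add: qfactors_def qpochhammer_def)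
      then show ?thesis by (simp add: qpochhammer_add power_add)
    qed
    have 4: "q ^ (i choose 2) * q ^ (i * (n - i)) * q ^ (l choose 2) =
        q ^ ((i + l) choose 2) * q ^ (i * (n - (i + l)))"
    proof -
      obtain d where "n = i + l + d" using l le_Suc_ex by blast
      then show ?thesis by (simp add: choose_two_add power_add algebra_simps)
    qed
    have 5: "(-1) ^ (i + l) * (-1) ^ i = (-1 :: 'a) ^ l"
      by (simp add: power_add flip: power_mult_distrib)
    have "?f (i + l) = qbinomial q n (i + l) * (qpochhammer B q (i + l) * (q / B) ^ (i + l)) *
        ((\<Prod>t<i. q ^ (n - t) - q ^ (n - (i + l))) / qpochhammer q q (i + l)) *
        (-1) ^ (i + l) * q ^ ((i + l) choose 2)"
      by (simp only: times_divide_eq_right times_divide_eq_left mult_ac)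
    also have "\<dots> = qbinomial q (n - i) l * qpochhammer (q ^ Suc i * q ^ l) q (n - i - l) / qpochhammer q q (n - i) *
        (qpochhammer B q i * (q / B) ^ i * qfactors ?x (q ^ Suc i) q l) *
        ((-1) ^ (i + l) * (-1) ^ i) * (q ^ ((i + l) choose 2) * q ^ (i * (n - (i + l))))"
      unfolding 1 2 3 using nz[of l] l by simp
    also have "\<dots> = ?c * (qbinomial q (n - i) l * ((-1) ^ l * q ^ (l choose 2) *
      qfactors ?x (q ^ Suc i) q l * qpochhammer (q ^ Suc i * q ^ l) q (n - i - l)))"
      unfolding 5 4[symmetric] by (simp only: times_divide_eq_right times_divide_eq_left mult_ac)
    finally show "?f (i + l) = ?c * (qbinomial q (n - i) l * ((-1) ^ l * q ^ (l choose 2) *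
      qfactors ?x (q ^ Suc i) q l * qpochhammer (q ^ Suc i * q ^ l) q (n - i - l)))" .
  qed auto
  also have "\<dots> = ?R"
    unfolding sum_distrib_left[symmetric] q_vandermonde by simp
  finally show ?thesis .
qed

text \<open>Since \<open>A B = q^n\<close>, each \<open>B (A - q^(t+1))\<close> equals
  \<open>- q^(t+1) (B - q^(n-t-1))\<close>. The \<open>A\<close>-factors thus complete the
  \<open>B\<close>-factors to the exponents \<open>1\<close> to \<open>n - 1\<close>, leaving over
  those with exponents \<open>n - j\<close> and \<open>n - j + 1\<close>. The leading
  \<open>q\<close> avoids the exponent \<open>n - j\<close>, which is negative at
  \<open>j = n + 1\<close>.\<close>

lemma qfactors_complement:
  fixes q A B :: "'a :: field"
  assumes "A * B = q ^ n" and "\<And>i. B \<noteq> q ^ i"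
  shows "j \<le> Suc n \<Longrightarrow> n \<noteq> 0 \<Longrightarrow> q * (B ^ j * qfactors A q q j * qfactors B q q (Suc n - j)) =
    (-1) ^ j * q ^ (j choose 2) * q ^ j * qfactors B q q (n - 1) *
      ((q * B - q ^ (Suc n - j)) * (B - q ^ (Suc n - j)))"
proof (induction j)
  case 0
  then obtain m where "n = Suc m" using not0_implies_Suc by blast
  then show ?case by (simp add: qfactors_Suc binomial_eq_0 algebra_simps)
next
  case (Suc j)
  then obtain d where d: "n = j + d" using le_Suc_ex by auto
  have 1: "Suc n - j = Suc d" "Suc n - Suc j = d" by (simp_all add: d)
  have 2: "q * (B * (A - q * q ^ j)) = - (q ^ Suc j * (q * B - q ^ d))"
    using assms(1) by (simp add: d power_add algebra_simps)
  \<comment> \<open>Passing to \<open>Suc j\<close> drops \<open>B - q ^ Suc d\<close> from the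
    \<open>B\<close>-factors; it is restored here and cancelled at the end, as \<open>B\<close> is
    no power of \<open>q\<close>.\<close>
  have "q * (B ^ Suc j * qfactors A q q (Suc j) * qfactors B q q d) * (B - q ^ Suc d)
    = q * (B ^ j * qfactors A q q j * qfactors B q q (Suc d)) * (B * (A - q * q ^ j))"
    by (simp only: qfactors_Suc power_Suc mult_ac)
  also have "\<dots> = (-1) ^ j * q ^ (j choose 2) * q ^ j * qfactors B q q (n - 1) *
      ((q * B - q ^ Suc d) * (B - q ^ Suc d)) * (B * (A - q * q ^ j))"
    using Suc by (simp only: 1) simp
  also have "\<dots> = (-1) ^ j * q ^ (j choose 2) * q ^ j * qfactors B q q (n - 1) *
      ((B - q ^ d) * (B - q ^ Suc d)) * (q * (B * (A - q * q ^ j)))"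
    by (simp add: algebra_simps)
  also have "\<dots> = (-1) ^ Suc j * q ^ (Suc j choose 2) * q ^ Suc j * qfactors B q q (n - 1) *
      ((q * B - q ^ d) * (B - q ^ d)) * (B - q ^ Suc d)"
    unfolding 2 choose_two_Suc power_add
    by (simp only: power_Suc mult_minus_left mult_minus_right mult_ac mult_1 mult_1_right minus_minus)
  finally show ?case
    unfolding 1 using assms(2)[of "Suc d"]
    by (simp only: mult_cancel_right right_minus_eq) simp
qed

text \<open>
  In \<open>q_sheppard\<close> the factor outside \<open>qfactors B q q (n - 1)\<close> is quadratic in the \<open>(n + 1 - j)\<close>-th power
  of \<open>q\<close>; its Newton expansion at the nodes \<open>n + 1\<close>, \<open>n\<close> turns the sum into three weighted
  Vandermonde sums \<open>W 0\<close>, \<open>W 1\<close>, \<open>W 2\<close>.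
\<close>
lemma q_sheppard_double_factor:
  fixes q A B :: "'a :: field"
  assumes q: "q \<noteq> 0" and root: "\<And>i. 0 < i \<Longrightarrow> i \<le> Suc n \<Longrightarrow> q ^ i \<noteq> 1"
    and B: "B \<noteq> 0" "\<And>i. B \<noteq> q ^ i" and AB: "A * B = q ^ n" and n: "n \<noteq> 0"
  defines "W \<equiv> \<lambda>i. q ^ (i choose 2) * q ^ (i * (Suc n - i)) * qpochhammer B q i * (q / B) ^ i *
      qpochhammer (q / B) q (Suc n - i) / qpochhammer q q (Suc n - i)"
  shows "q * qpochhammer q q (Suc n) *
      (\<Sum>k\<le>Suc n. qpochhammer (1 / q ^ Suc n) q k * qpochhammer A q k * qpochhammer B q k * q ^ k /
        qpochhammer q q k ^ 3) =
    qfactors B q q (n - 1) *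
      (q * (B - q ^ n) * (B - q ^ Suc n) * W 0 + (1 + q) * (B - q ^ n) * W 1 + W 2)"
    (is "_ * _ * ?S = ?H * (?c0 * _ + ?c1 * _ + _)")
proof -
  let ?w = "\<lambda>i j. (-1) ^ j * q ^ (j choose 2) * qpochhammer B q j * (q / B) ^ j *
      (\<Prod>t<i. q ^ (Suc n - t) - q ^ (Suc n - j)) / qpochhammer q q j"
  have W: "(\<Sum>j\<le>Suc n. qbinomial q (Suc n) j * ?w i j) = W i" if "i \<le> 2" for i
    unfolding W_def by (rule q_vandermonde_weighted[OF B(1) root]) (use that n in auto)
  have prods: "(\<Prod>t<0. q ^ (Suc n - t) - y) = 1"
    "(\<Prod>t<1. q ^ (Suc n - t) - y) = q ^ Suc n - y"
    "(\<Prod>t<2. q ^ (Suc n - t) - y) = (q ^ Suc n - y) * (q ^ n - y)" for y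
    by (simp_all add: numeral_2_eq_2)
  \<comment> \<open>The coefficients \<open>?c0\<close> and \<open>?c1\<close> come from evaluation
    at \<open>y = q^(n+1)\<close> and \<open>y = q^n\<close>; the leading coefficient is 1.\<close>
  have quad: "(q * B - y) * (B - y) =
    ?c0 + ?c1 * (q ^ Suc n - y) + (q ^ Suc n - y) * (q ^ n - y)" for y
    by (simp add: algebra_simps)
  have summand: "q * (qbinomial q (Suc n) j * qpochhammer B q j * qfactors A q q j *
        qfactors B q q (Suc n - j) / qpochhammer q q j) =
      ?H * (?c0 * (qbinomial q (Suc n) j * ?w 0 j) + ?c1 * (qbinomial q (Suc n) j * ?w 1 j) +
        qbinomial q (Suc n) j * ?w 2 j)" if "j \<le> Suc n" for j
  proof -
    let ?y = "q ^ (Suc n - j)"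
    \<comment> \<open>Multiplying and dividing by \<open>B ^ j\<close> makes
      \<open>qfactors_complement\<close> applicable; with the \<open>q ^ j\<close> arising there it
      yields \<open>(q / B) ^ j\<close>.\<close>
    have "q * (qfactors A q q j * qfactors B q q (Suc n - j)) =
        q * (B ^ j * qfactors A q q j * qfactors B q q (Suc n - j)) / B ^ j"
      using B(1) by simp
    also have "\<dots> = (-1) ^ j * q ^ (j choose 2) * (q / B) ^ j * ?H * ((q * B - ?y) * (B - ?y))"
      unfolding qfactors_complement[OF AB B(2) that n]
      by (simp add: power_divide)
    finally have "q * (qfactors A q q j * qfactors B q q (Suc n - j)) =
        (-1) ^ j * q ^ (j choose 2) * (q / B) ^ j * ?H *
        (?c0 + ?c1 * (q ^ Suc n - ?y) + (q ^ Suc n - ?y) * (q ^ n - ?y))"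
      unfolding quad .
    then have "q * (qbinomial q (Suc n) j * qpochhammer B q j * qfactors A q q j *
        qfactors B q q (Suc n - j) / qpochhammer q q j) =
        qbinomial q (Suc n) j * qpochhammer B q j / qpochhammer q q j *
        ((-1) ^ j * q ^ (j choose 2) * (q / B) ^ j * ?H *
        (?c0 + ?c1 * (q ^ Suc n - ?y) + (q ^ Suc n - ?y) * (q ^ n - ?y)))"
      by (metis (no_types, opaque_lifting) mult.assoc mult.left_commute times_divide_eq_left times_divide_eq_right)
    also have "\<dots> = ?H * (?c0 * (qbinomial q (Suc n) j * ?w 0 j) + ?c1 * (qbinomial q (Suc n) j * ?w 1 j) +
        qbinomial q (Suc n) j * ?w 2 j)"
      unfolding prods
      by (simp only: distrib_left times_divide_eq_right times_divide_eq_left mult_ac mult_1_left mult_1_right add_divide_distrib)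
    finally show ?thesis .
  qed
  have "q * qpochhammer q q (Suc n) * ?S = q * (qpochhammer q q (Suc n) * ?S)"
    by (rule mult.assoc)
  also have "\<dots> = q * (\<Sum>j\<le>Suc n. qbinomial q (Suc n) j * qpochhammer B q j *
      qfactors A q q j * qfactors B q q (Suc n - j) / qpochhammer q q j)"
    by (rule arg_cong[OF q_sheppard[OF q root]])
  also have "\<dots> = (\<Sum>j\<le>Suc n. q * (qbinomial q (Suc n) j * qpochhammer B q j *
      qfactors A q q j * qfactors B q q (Suc n - j) / qpochhammer q q j))"
    by (rule sum_distrib_left)
  also have "\<dots> = (\<Sum>j\<le>Suc n. ?H * (?c0 * (qbinomial q (Suc n) j * ?w 0 j) +
      ?c1 * (qbinomial q (Suc n) j * ?w 1 j) + qbinomial q (Suc n) j * ?w 2 j))"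
    using summand by (intro sum.cong) auto
  also have "\<dots> = ?H * (?c0 * (\<Sum>j\<le>Suc n. qbinomial q (Suc n) j * ?w 0 j) +
      ?c1 * (\<Sum>j\<le>Suc n. qbinomial q (Suc n) j * ?w 1 j) + (\<Sum>j\<le>Suc n. qbinomial q (Suc n) j * ?w 2 j))"
    by (simp only: sum.distrib flip: sum_distrib_left)
  also have "\<dots> = ?H * (?c0 * W 0 + ?c1 * W 1 + W 2)"
    by (simp only: W)
  finally show ?thesis .
qed

section \<open>Localisation at a cyclotomic polynomial\<close>

lemma to_fract_power: "to_fract (x ^ k) = to_fract x ^ k"
  by (induction k) simp_all

text \<open>The \<open>e\<close>-th power of the ideal generated by \<open>P\<close> in the localisation at \<open>P\<close>; \<open>e = 0\<close> gives the local ring itself.\<close>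
definition local_ideal :: "rat poly \<Rightarrow> nat \<Rightarrow> rat poly fract set" where
  "local_ideal P e = {to_fract (P ^ e * a) / to_fract b | a b. b \<noteq> 0 \<and> coprime b P}"

lemma local_idealI:
  "b \<noteq> 0 \<Longrightarrow> coprime b P \<Longrightarrow> x = to_fract (P ^ e * a) / to_fract b \<Longrightarrow> x \<in> local_ideal P e"
  by (auto simp: local_ideal_def)

lemma local_idealE:
  assumes "x \<in> local_ideal P e"
  obtains a b where "b \<noteq> 0" "coprime b P" "x = to_fract (P ^ e * a) / to_fract b"
  using assms by (auto simp: local_ideal_def)

lemma local_ideal_add:
  assumes "x \<in> local_ideal P e" "y \<in> local_ideal P e"
  shows "x + y \<in> local_ideal P e"
proof -
  obtain a b where "b \<noteq> 0" "coprime b P" "x = to_fract (P ^ e * a) / to_fract b"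
    using assms(1) by (rule local_idealE)
  moreover obtain c d where "d \<noteq> 0" "coprime d P" "y = to_fract (P ^ e * c) / to_fract d"
    using assms(2) by (rule local_idealE)
  ultimately show ?thesis
    by (intro local_idealI[of "b * d" P _ e "a * d + c * b"]) (auto simp: field_simps)
qed

lemma local_ideal_mult:
  assumes "x \<in> local_ideal P d" "y \<in> local_ideal P e"
  shows "x * y \<in> local_ideal P (d + e)"
proof -
  obtain a b where "b \<noteq> 0" "coprime b P" "x = to_fract (P ^ d * a) / to_fract b"
    using assms(1) by (rule local_idealE)
  moreover obtain a' b' where "b' \<noteq> 0" "coprime b' P" "y = to_fract (P ^ e * a') / to_fract b'"
    using assms(2) by (rule local_idealE)
  ultimately show ?thesis
    by (intro local_idealI[of "b * b'" P _ "d + e" "a * a'"]) (simp_all add: power_add mult_ac)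
qed

lemma local_ideal_0: "0 \<in> local_ideal P e"
  by (rule local_idealI[of 1 P _ e 0]) auto

lemma local_ideal_to_fract: "to_fract a \<in> local_ideal P 0"
  by (rule local_idealI[of 1 P _ 0 a]) auto

lemma local_ideal_1: "1 \<in> local_ideal P 0"
  using local_ideal_to_fract[of 1 P] by simp

lemma local_ideal_dvd: "P dvd a \<Longrightarrow> to_fract a \<in> local_ideal P 1"
  by (elim dvdE, rule local_idealI[of 1 P _ 1]) auto

lemma local_ideal_inverse: "b \<noteq> 0 \<Longrightarrow> coprime b P \<Longrightarrow> 1 / to_fract b \<in> local_ideal P 0"
  by (rule local_idealI[of b P _ 0 1]) auto

lemma local_ideal_mult_left: "x \<in> local_ideal P 0 \<Longrightarrow> y \<in> local_ideal P e \<Longrightarrow> x * y \<in> local_ideal P e"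
  using local_ideal_mult[of x P 0 y e] by simp

lemma local_ideal_mult_right: "x \<in> local_ideal P e \<Longrightarrow> y \<in> local_ideal P 0 \<Longrightarrow> x * y \<in> local_ideal P e"
  using local_ideal_mult[of x P e y 0] by simp

lemma local_ideal_uminus: "x \<in> local_ideal P e \<Longrightarrow> - x \<in> local_ideal P e"
  using local_ideal_mult_left[OF local_ideal_to_fract[of "- 1"]] by simp

lemma local_ideal_diff: "x \<in> local_ideal P e \<Longrightarrow> y \<in> local_ideal P e \<Longrightarrow> x - y \<in> local_ideal P e"
  using local_ideal_add[OF _ local_ideal_uminus] by fastforce

lemma local_ideal_sum: "(\<And>i. i \<in> A \<Longrightarrow> f i \<in> local_ideal P e) \<Longrightarrow> sum f A \<in> local_ideal P e"
  by (induction A rule: infinite_finite_induct) (auto intro: local_ideal_add local_ideal_0)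

lemma local_ring_prod: "(\<And>i. i \<in> A \<Longrightarrow> f i \<in> local_ideal P 0) \<Longrightarrow> prod f A \<in> local_ideal P 0"
  by (induction A rule: infinite_finite_induct) (auto intro: local_ideal_mult_left local_ideal_1)

lemma local_ring_power: "x \<in> local_ideal P 0 \<Longrightarrow> x ^ k \<in> local_ideal P 0"
  by (induction k) (auto intro: local_ideal_mult_left local_ideal_1)

section \<open>Laurent polynomials and the congruence relation\<close>

lemma qvar_nonzero [simp]: "qvar \<noteq> 0"
  by (simp add: qvar_def)

lemma laurent_polys_add: "x \<in> laurent_polys \<Longrightarrow> y \<in> laurent_polys \<Longrightarrow> x + y \<in> laurent_polys"
proof -
  assume "x \<in> laurent_polys" "y \<in> laurent_polys"
  then obtain a k b l where "x = to_fract a / qvar ^ k" "y = to_fract b / qvar ^ l"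
    by (auto simp: laurent_polys_def)
  then have "x + y = to_fract (a * [:0, 1:] ^ l + b * [:0, 1:] ^ k) / qvar ^ (k + l)"
    by (simp add: add_frac_eq power_add to_fract_power flip: qvar_def)
  then show ?thesis unfolding laurent_polys_def by blast
qed

lemma laurent_polys_mult: "x \<in> laurent_polys \<Longrightarrow> y \<in> laurent_polys \<Longrightarrow> x * y \<in> laurent_polys"
proof -
  assume "x \<in> laurent_polys" "y \<in> laurent_polys"
  then obtain a k b l where "x = to_fract a / qvar ^ k" "y = to_fract b / qvar ^ l"
    by (auto simp: laurent_polys_def)
  then have "x * y = to_fract (a * b) / qvar ^ (k + l)"
    by (simp add: power_add)
  then show ?thesis unfolding laurent_polys_def by blast
qed

lemma to_fract_in_laurent_polys: "to_fract a \<in> laurent_polys"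
proof -
  have "to_fract a = to_fract a / qvar ^ 0" by simp
  then show ?thesis unfolding laurent_polys_def by blast
qed

lemma laurent_dvd_to_fractI:
  assumes "a dvd b"
  shows "laurent_dvd (to_fract a) (to_fract b)"
proof -
  obtain c where "b = a * c" using assms ..
  then show ?thesis
    unfolding laurent_dvd_def by (intro bexI[of _ "to_fract c"] to_fract_in_laurent_polys) simp
qed

text \<open>A Bezout identity between the polynomials persists in the Laurent ring, so every common
  divisor there divides 1.\<close>

lemma laurent_coprime_to_fractI:
  fixes a b :: "rat poly"
  assumes "coprime a b"
  shows "laurent_coprime (to_fract a) (to_fract b)"
  unfolding laurent_coprime_def
proof (intro ballI impI)
  fix D assume "laurent_dvd D (to_fract a)" "laurent_dvd D (to_fract b)"
  then obtain x y where xy: "x \<in> laurent_polys" "y \<in> laurent_polys" "to_fract a = D * x" "to_fract b = D * y"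
    by (auto simp: laurent_dvd_def)
  obtain u v where "u * a + v * b = 1"
    using assms bezout_coefficients_fst_snd[of a b] by (metis coprime_iff_gcd_eq_1)
  then have "to_fract u * to_fract a + to_fract v * to_fract b = 1"
    by (metis to_fract_1 to_fract_add to_fract_mult)
  then have "1 = D * (to_fract u * x + to_fract v * y)"
    unfolding xy by (simp add: algebra_simps)
  then show "laurent_dvd D 1"
    unfolding laurent_dvd_def
    using xy by (auto intro!: laurent_polys_add laurent_polys_mult to_fract_in_laurent_polys)
qed

lemma ratfun_cong_0I:
  assumes "x \<in> local_ideal P e"
  shows "ratfun_cong x 0 (P ^ e)"
proof -
  from assms obtain a b where "b \<noteq> 0" "coprime b P" "x = to_fract (P ^ e * a) / to_fract b"
    by (rule local_idealE)
  then show ?thesis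
    unfolding ratfun_cong_def
    by (intro bexI[of _ "to_fract (P ^ e * a)"] bexI[of _ "to_fract b"] conjI[rotated]
        laurent_coprime_to_fractI laurent_dvd_to_fractI to_fract_in_laurent_polys) simp_all
qed

section \<open>Units and multiples at a cyclotomic polynomial\<close>

lemma coprime_cyclotomicI:
  assumes "n > 0" and "\<And>z. z \<in> primitive_roots_unity n \<Longrightarrow> poly (map_poly of_rat f) z \<noteq> 0"
  shows "coprime f (cyclotomic n)"
proof (rule coprimeI)
  fix d assume d: "d dvd f" "d dvd cyclotomic n"
  let ?h = "map_poly of_rat :: rat poly \<Rightarrow> complex poly"
  have dvd: "?h a dvd ?h b" if "a dvd b" for a b
    using that by (auto simp: map_poly_of_rat_mult elim!: dvdE)
  have fin: "finite (primitive_roots_unity n)"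
    using assms(1) unfolding primitive_roots_unity_def
    by (intro finite_subset[OF _ finite_roots_unity[of n]]) auto
  \<comment> \<open>A root of \<open>d\<close> would be a primitive root of unity at which
    \<open>f\<close> vanishes; without complex roots, \<open>d\<close> is constant.\<close>
  have no_root: "poly (?h d) z \<noteq> 0" for z
  proof
    assume "poly (?h d) z = 0"
    then have z: "poly (?h f) z = 0" "poly (?h (cyclotomic n)) z = 0"
      using dvd[OF d(1)] dvd[OF d(2)] by (auto elim!: dvdE)
    then have "z \<in> primitive_roots_unity n"
      using fin by (simp add: of_rat_cyclotomic[OF assms(1)] poly_prod)
    then show False using assms(2) z(1) by blast
  qed
  then have "constant (poly (?h d))"
    using fundamental_theorem_of_algebra by blast
  then have "degree d = 0"
    by (simp add: constant_degree degree_map_poly)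
  moreover have "d \<noteq> 0" using no_root[of 0] by auto
  ultimately show "is_unit d" by (simp add: is_unit_iff_degree)
qed

text \<open>The complex factorisation of \<open>x^n - 1\<close> descends to the rationals because
  the embedding of coefficients is injective.\<close>

lemma cyclotomic_dvd_monom:
  assumes "n > 0"
  shows "cyclotomic n dvd monom 1 n - 1"
proof -
  have "map_poly of_rat (\<Prod>d | d dvd n. cyclotomic d) = (monom 1 n - 1 :: complex poly)"
    unfolding map_poly_of_rat_prod prod_primitive_roots_unity[OF assms, symmetric]
    using assms by (intro prod.cong refl of_rat_cyclotomic) (auto intro: Nat.gr0I)
  also have "\<dots> = map_poly of_rat (monom 1 n - 1)"
    by (rule poly_eqI) (auto simp: coeff_map_poly)
  finally have "(\<Prod>d | d dvd n. cyclotomic d) = monom 1 n - 1"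
    by (rule map_poly_of_rat_inj)
  then show ?thesis
    using assms by (metis dvd_refl dvd_prod_eqI finite_divisors_nat mem_Collect_eq)
qed

lemma qvar_power: "qvar ^ k = to_fract (monom 1 k)"
  by (induction k) (simp_all add: qvar_def monom_Suc flip: to_fract_mult)

lemma qvar_power_eq_iff [simp]: "qvar ^ j = qvar ^ k \<longleftrightarrow> j = k"
  by (simp add: qvar_power monom_eq_iff')

lemma qvar_power_eq_1_iff [simp]: "qvar ^ j = 1 \<longleftrightarrow> j = 0"
  using qvar_power_eq_iff[of j 0] by simp

lemma qvar_mem: "qvar ^ k \<in> local_ideal P 0"
  by (simp add: qvar_power local_ideal_to_fract)

text \<open>Powers of \<open>q\<close> are units here because 0 is not a primitive root of
  unity.\<close>

lemma inverse_qvar_mem: "n > 0 \<Longrightarrow> 1 / qvar ^ k \<in> local_ideal (cyclotomic n) 0"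
  unfolding qvar_power
  by (intro local_ideal_inverse coprime_cyclotomicI)
     (auto simp: map_poly_monom poly_monom primitive_roots_unity_def zero_power)

lemma one_minus_qvar_power_mem:
  assumes "n > 0"
  shows "1 - qvar ^ (m * n) \<in> local_ideal (cyclotomic n) 1"
proof -
  have "(monom 1 n :: rat poly) - 1 dvd monom 1 n ^ m - 1"
    by (metis dvd_triv_left power_diff_1_eq)
  then have "cyclotomic n dvd monom 1 (m * n) - 1"
    using cyclotomic_dvd_monom[OF assms] dvd_trans
    by (simp add: monom_power mult.commute) blast
  then have "cyclotomic n dvd 1 - monom 1 (m * n)"
    by (metis dvd_minus_iff minus_diff_eq)
  from local_ideal_dvd[OF this] show ?thesis by (simp add: qvar_power)
qed

text \<open>A primitive \<open>n\<close>-th root of unity satisfies \<open>z ^ j = 1\<close> only if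
  \<open>n\<close> divides \<open>j\<close>.\<close>

lemma inverse_one_minus_qvar_power_mem:
  assumes "n > 0" "\<not> n dvd j"
  shows "1 / (1 - qvar ^ j) \<in> local_ideal (cyclotomic n) 0"
proof -
  have "monom 1 j \<noteq> (1 :: rat poly)"
    using assms(2) by (metis dvd_0_right monom_eq_1_iff)
  moreover have "coprime (1 - monom 1 j) (cyclotomic n)"
  proof (rule coprime_cyclotomicI[OF assms(1)])
    fix z assume z: "z \<in> primitive_roots_unity n"
    have "z ^ j = z ^ (n * (j div n) + j mod n)" by simp
    also have "\<dots> = z ^ (j mod n)"
      using z by (simp only: power_add power_mult) (simp add: primitive_roots_unity_def)
    finally have "z ^ j \<noteq> 1"
      using z assms by (auto simp: primitive_roots_unity_def dvd_eq_mod_eq_0)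
    moreover have "map_poly of_rat (1 - monom 1 j) = (1 - monom 1 j :: complex poly)"
      by (rule poly_eqI) (auto simp: coeff_map_poly)
    ultimately show "poly (map_poly of_rat (1 - monom 1 j)) z \<noteq> 0"
      by (simp add: poly_monom)
  qed
  ultimately have "1 / to_fract (1 - monom 1 j) \<in> local_ideal (cyclotomic n) 0"
    by (intro local_ideal_inverse) auto
  then show ?thesis by (simp add: qvar_power)
qed

section \<open>The congruences\<close>

lemma qpochhammer_mem:
  "a \<in> local_ideal P 0 \<Longrightarrow> q \<in> local_ideal P 0 \<Longrightarrow> qpochhammer a q k \<in> local_ideal P 0"
  unfolding qpochhammer_def
  by (intro local_ring_prod local_ideal_diff local_ideal_mult_left local_ring_power local_ideal_1)

lemma qfactors_mem:
  "a \<in> local_ideal P 0 \<Longrightarrow> c \<in> local_ideal P 0 \<Longrightarrow> q \<in> local_ideal P 0 \<Longrightarrow>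
    qfactors a c q k \<in> local_ideal P 0"
  unfolding qfactors_def
  by (intro local_ring_prod local_ideal_diff local_ideal_mult_left local_ring_power)

lemma qpochhammer_mem_1:
  assumes "a \<in> local_ideal P 0" "q \<in> local_ideal P 0" "1 - a * q ^ i \<in> local_ideal P 1" "i < k"
  shows "qpochhammer a q k \<in> local_ideal P 1"
proof -
  obtain d where "k = Suc i + d" using assms(4) by (metis Suc_leI le_Suc_ex)
  then have "qpochhammer a q k = qpochhammer a q i * (1 - a * q ^ i) * qpochhammer (a * q ^ Suc i) q d"
    by (simp only: qpochhammer_add qpochhammer_Suc)
  moreover have "qpochhammer a q i * (1 - a * q ^ i) \<in> local_ideal P 1"
    by (intro local_ideal_mult_left qpochhammer_mem assms)
  ultimately show ?thesis
    using assms by (simp only:) (intro local_ideal_mult_right qpochhammer_mem local_ideal_mult_left local_ring_power)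
qed

text \<open>A single factor changes by
  \<open>(1 - x)^2 - (1 - x/u) (1 - x u) = (x/u) (1 - u)^2\<close>, which is of second order in
  \<open>1 - u\<close>.\<close>

lemma qpochhammer_square_deform:
  fixes a q u :: "rat poly fract"
  assumes "a \<in> local_ideal P 0" "q \<in> local_ideal P 0" "u \<in> local_ideal P 0" "1 / u \<in> local_ideal P 0"
    "1 - u \<in> local_ideal P 1" "u \<noteq> 0"
  shows "qpochhammer a q k ^ 2 - qpochhammer (a / u) q k * qpochhammer (a * u) q k \<in> local_ideal P 2"
proof (induction k)
  case (Suc k)
  let ?x = "a * q ^ k"
  have au: "a / u \<in> local_ideal P 0"
    using local_ideal_mult_left[OF assms(1,4)] by simp
  have "(1 - u) * (1 - u) \<in> local_ideal P 2"
    using local_ideal_mult[OF assms(5,5)] by (simp add: numeral_2_eq_2)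
  moreover have "qpochhammer a q k ^ 2 * (?x * (1 / u)) \<in> local_ideal P 0"
    by (intro local_ideal_mult_left local_ring_power qpochhammer_mem assms)
  moreover have "(1 - a / u * q ^ k) * (1 - a * u * q ^ k) \<in> local_ideal P 0"
    by (intro local_ideal_mult_left local_ideal_diff local_ring_power local_ideal_1 au assms)
  \<comment> \<open>With \<open>F\<close> the old factorial, \<open>H\<close> its deformed square
    and \<open>G\<close> the new deformed factor, the next difference is
    \<open>F^2 ((1 - x)^2 - G) + (F^2 - H) G\<close>.\<close>
  ultimately have "qpochhammer a q k ^ 2 * (?x * (1 / u)) * ((1 - u) * (1 - u)) +
      (qpochhammer a q k ^ 2 - qpochhammer (a / u) q k * qpochhammer (a * u) q k) *
      ((1 - a / u * q ^ k) * (1 - a * u * q ^ k)) \<in> local_ideal P 2"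
    by (intro local_ideal_add local_ideal_mult_left[of "_ * (?x * _)"] local_ideal_mult_right[OF Suc.IH])
  also have "qpochhammer a q k ^ 2 * (?x * (1 / u)) * ((1 - u) * (1 - u)) +
      (qpochhammer a q k ^ 2 - qpochhammer (a / u) q k * qpochhammer (a * u) q k) *
      ((1 - a / u * q ^ k) * (1 - a * u * q ^ k)) =
      qpochhammer a q (Suc k) ^ 2 - qpochhammer (a / u) q (Suc k) * qpochhammer (a * u) q (Suc k)"
    using assms(6) by (simp add: qpochhammer_Suc power2_eq_square field_simps)
  finally show ?case .
qed (simp add: local_ideal_0)

text \<open>The factor of \<open>(p/B; p)\<close> with index \<open>i\<close> is \<open>1 - q\<close> to the power \<open>m' n\<close>.\<close>
lemma sum_mem_local_ideal_2:
  fixes n r s m m' N i :: nat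
  assumes n: "n > 0" "coprime n 9"
    and rs: "2 * r + s = 9" "s > 0"
    and N: "9 * Suc N = m * n + r" "Suc N < n"
    and i: "9 * Suc i + s = m' * n" "i < N - 1"
  defines "a \<equiv> 1 / qvar ^ r" and "B \<equiv> 1 / qvar ^ s" and "p \<equiv> qvar ^ 9"
  shows "(\<Sum>k<n. qpochhammer a p k ^ 2 * qpochhammer B p k * p ^ k / qpochhammer p p k ^ 3)
    \<in> local_ideal (cyclotomic n) 2"
proof -
  let ?P = "cyclotomic n"
  define u where "u = qvar ^ (m * n)"
  note ring = local_ideal_add local_ideal_diff local_ideal_mult_left local_ring_power local_ideal_1
    local_ideal_sum qpochhammer_mem qfactors_mem
  have mem: "a \<in> local_ideal ?P 0" "B \<in> local_ideal ?P 0" "p \<in> local_ideal ?P 0"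
    "u \<in> local_ideal ?P 0" "1 / u \<in> local_ideal ?P 0" "1 / p \<in> local_ideal ?P 0"
    unfolding a_def B_def p_def u_def using qvar_mem inverse_qvar_mem[OF n(1)] by auto
  have nz: "p \<noteq> 0" "u \<noteq> 0" "B \<noteq> 0" by (auto simp: p_def u_def B_def)
  have pk: "p ^ k = qvar ^ (9 * k)" for k by (simp add: p_def power_mult)
  have root: "p ^ k \<noteq> 1" if "0 < k" for k using that by (simp add: pk)
  \<comment> \<open>The factors are \<open>1 - q^(9 (j+1))\<close> with \<open>j + 1 < n\<close>; as
    \<open>n\<close> is coprime to 9, it does not divide the exponent.\<close>
  have inv: "1 / qpochhammer p p k \<in> local_ideal ?P 0" if "k < n" for k
  proof -
    have "1 / (1 - p * p ^ j) \<in> local_ideal ?P 0" if "j < k" for j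
    proof -
      have "\<not> n dvd Suc j" using \<open>k < n\<close> that by (simp add: nat_dvd_not_less)
      then have "\<not> n dvd 9 * Suc j" using n(2) coprime_dvd_mult_right_iff by blast
      then show ?thesis
        using inverse_one_minus_qvar_power_mem[OF n(1)] pk[of "Suc j"] by simp
    qed
    then have "(\<Prod>j<k. 1 / (1 - p * p ^ j)) \<in> local_ideal ?P 0"
      by (intro local_ring_prod) auto
    then show ?thesis by (simp add: qpochhammer_def prod_dividef)
  qed
  have au: "a / u = 1 / p ^ Suc N"
    using N(1) by (simp only: pk a_def u_def) (simp add: power_add)
  \<comment> \<open>The exponent is
    \<open>m n - r - s = 9 (N + 1) - (2 r + s) = 9 N\<close>.\<close>
  have AB: "a * u * B = p ^ N"
  proof -
    have "qvar ^ (9 * N) * (qvar ^ r * qvar ^ s) = qvar ^ (m * n)"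
      using N(1) rs(1) by (simp flip: power_add)
    from this[symmetric] show ?thesis unfolding pk by (simp add: a_def u_def B_def)
  qed
  \<comment> \<open>The exponent of \<open>q\<close> in \<open>B\<close> is negative.\<close>
  have B: "B \<noteq> p ^ j" for j
  proof -
    have "qvar ^ (9 * j + s) \<noteq> 1" using rs(2) by simp
    then show ?thesis unfolding pk by (auto simp: B_def power_add field_simps)
  qed
  define S where "S = (\<Sum>k\<le>Suc N. qpochhammer (1 / p ^ Suc N) p k * qpochhammer (a * u) p k *
      qpochhammer B p k * p ^ k / qpochhammer p p k ^ 3)"
  have "S \<in> local_ideal ?P 2"
  proof -
    have pB: "p / B \<in> local_ideal ?P 0"
      using mem(3) qvar_mem[of s] by (simp add: B_def local_ideal_mult_left)
    have "1 - p / B * p ^ i \<in> local_ideal ?P 1"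
    proof -
      have "p / B * p ^ i = qvar ^ (m' * n)"
        using pk[of "Suc i"] by (simp add: B_def power_add flip: i(1))
      then show ?thesis using one_minus_qvar_power_mem[OF n(1)] by simp
    qed
    then have fac: "qpochhammer (p / B) p k \<in> local_ideal ?P 1" if "i < k" for k
      using that by (rule qpochhammer_mem_1[OF pB mem(3)])
    define W where "W = (\<lambda>j. p ^ (j choose 2) * p ^ (j * (Suc N - j)) * qpochhammer B p j * (p / B) ^ j *
      qpochhammer (p / B) p (Suc N - j) / qpochhammer p p (Suc N - j))"
    \<comment> \<open>Its shifted factorial of \<open>p / B\<close> has at least
      \<open>N - 1\<close> factors, so the one with index \<open>i\<close> is among them.\<close>
    have W: "W j \<in> local_ideal ?P 1" if "j \<le> 2" for j
    proof -
      have "p ^ (j choose 2) * p ^ (j * (Suc N - j)) * qpochhammer B p j * (p / B) ^ j *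
        (1 / qpochhammer p p (Suc N - j)) * qpochhammer (p / B) p (Suc N - j) \<in> local_ideal ?P 1"
        by (intro local_ideal_mult_left local_ring_power qpochhammer_mem mem pB fac inv)
           (use that i(2) N(2) in auto)
      then show ?thesis by (simp add: W_def)
    qed
    define C where "C = p * (B - p ^ N) * (B - p ^ Suc N) * W 0 + (1 + p) * (B - p ^ N) * W 1 + W 2"
    have C: "C \<in> local_ideal ?P 1"
      unfolding C_def by (intro ring mem W) auto
    \<comment> \<open>This is the other copy of the vanishing factor; together with \<open>C\<close>
      it gives the second power of the ideal.\<close>
    have H: "qfactors B p p (N - 1) \<in> local_ideal ?P 1"
    proof -
      have "qfactors B p p (N - 1) = B ^ (N - 1) * qpochhammer (p / B) p (N - 1)"
        using qfactors_scale[of B 1 "p / B" p "N - 1"] nz(3) by (simp add: qfactors_def qpochhammer_def)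
      then show ?thesis using fac[OF i(2)] mem by (auto intro!: ring)
    qed
    have "p * qpochhammer p p (Suc N) * S = qfactors B p p (N - 1) * C"
      unfolding S_def C_def W_def
      by (rule q_sheppard_double_factor[OF nz(1) root nz(3) B AB]) (use i(2) in auto)
    then have "S = (1 / p) * (1 / qpochhammer p p (Suc N)) * (qfactors B p p (N - 1) * C)"
      using nz(1) qpochhammer_nonzero[of "Suc N" p] root by (simp add: field_simps)
    moreover have "qfactors B p p (N - 1) * C \<in> local_ideal ?P 2"
      using local_ideal_mult[OF H C] by (simp add: numeral_2_eq_2)
    ultimately show ?thesis
      by (simp only:) (intro local_ideal_mult_left[of "_ * (1 / _)"] local_ideal_mult_left[of "1 / p"] mem inv[OF N(2)])
  qed
  \<comment> \<open>The terms beyond \<open>Suc N\<close> vanish and \<open>Suc N < n\<close>, so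
    the terminating sum may run over all \<open>k < n\<close>.\<close>
  have trunc: "S = (\<Sum>k<n. qpochhammer (a / u) p k * qpochhammer (a * u) p k * qpochhammer B p k * p ^ k /
      qpochhammer p p k ^ 3)"
  proof -
    have "qpochhammer (1 / p ^ Suc N) p k = 0" if "Suc N < k" for k
      unfolding qpochhammer_def using that nz(1) by (auto intro!: bexI[of _ "Suc N"])
    then show ?thesis
      unfolding S_def au using N(2) by (intro sum.mono_neutral_left) auto
  qed
  have "(\<Sum>k<n. (qpochhammer a p k ^ 2 - qpochhammer (a / u) p k * qpochhammer (a * u) p k) *
      (qpochhammer B p k * p ^ k * (1 / qpochhammer p p k) ^ 3)) \<in> local_ideal ?P 2"
    using mem nz one_minus_qvar_power_mem[OF n(1)]
    by (intro local_ideal_sum local_ideal_mult_right[OF qpochhammer_square_deform] local_ideal_mult_left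
        local_ring_power qpochhammer_mem inv) (auto simp: u_def)
  also have "(\<Sum>k<n. (qpochhammer a p k ^ 2 - qpochhammer (a / u) p k * qpochhammer (a * u) p k) *
      (qpochhammer B p k * p ^ k * (1 / qpochhammer p p k) ^ 3)) =
    (\<Sum>k<n. qpochhammer a p k ^ 2 * qpochhammer B p k * p ^ k / qpochhammer p p k ^ 3) - S"
    unfolding trunc sum_subtractf[symmetric]
    by (intro sum.cong refl) (simp add: divide_inverse power_inverse algebra_simps)
  finally show ?thesis
    using local_ideal_add[OF _ \<open>S \<in> _\<close>] by fastforce
qed

lemma ratfun_cong_sum:
  fixes n r s m m' N i :: nat
  assumes "n > 0" "coprime n 9" "2 * r + s = 9" "s > 0"
    "9 * Suc N = m * n + r" "Suc N < n" "9 * Suc i + s = m' * n" "i < N - 1"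
  shows "ratfun_cong
      (\<Sum>k = 0..n - 1.
         qpochhammer (qvar powi (- int r)) (qvar ^ 9) k ^ 2 *
         qpochhammer (qvar powi (- int s)) (qvar ^ 9) k * qvar ^ (9 * k) /
         qpochhammer (qvar ^ 9) (qvar ^ 9) k ^ 3)
      0 (cyclotomic n ^ 2)"
proof -
  have "{0..n - 1} = {..<n}" using assms(1) by auto
  moreover have "qvar powi (- int k) = 1 / qvar ^ k" for k
    by (simp add: power_int_minus field_simps)
  ultimately show ?thesis
    using ratfun_cong_0I[OF sum_mem_local_ideal_2[OF assms]] by (simp add: power_mult)
qed

theorem theorem5p2:
  fixes n :: nat
  assumes "n > 9"
  shows
    "([n = 5] (mod 9) \<longrightarrow>
        ratfun_cong
          (\<Sum>k = 0..n - 1.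
             qpochhammer (qvar powi (-1)) (qvar ^ 9) k ^ 2 *
             qpochhammer (qvar powi (-7)) (qvar ^ 9) k * qvar ^ (9 * k) /
             qpochhammer (qvar ^ 9) (qvar ^ 9) k ^ 3)
          0 (cyclotomic n ^ 2)) \<and>
     ([n = 2] (mod 9) \<or> [n = 5] (mod 9) \<longrightarrow>
        ratfun_cong
          (\<Sum>k = 0..n - 1.
             qpochhammer (qvar powi (-2)) (qvar ^ 9) k ^ 2 *
             qpochhammer (qvar powi (-5)) (qvar ^ 9) k * qvar ^ (9 * k) /
             qpochhammer (qvar ^ 9) (qvar ^ 9) k ^ 3)
          0 (cyclotomic n ^ 2)) \<and>
     ([n = 2] (mod 9) \<longrightarrow>
        ratfun_cong
          (\<Sum>k = 0..n - 1.
             qpochhammer (qvar powi (-4)) (qvar ^ 9) k ^ 2 *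
             qpochhammer (qvar powi (-1)) (qvar ^ 9) k * qvar ^ (9 * k) /
             qpochhammer (qvar ^ 9) (qvar ^ 9) k ^ 3)
          0 (cyclotomic n ^ 2))"
proof -
  \<comment> \<open>Since \<open>n > 9\<close>, the quotient by 9 is positive, and
    \<open>Suc\<close> records this.\<close>
  have n: "n = 9 * Suc (n div 9 - 1) + n mod 9"
    using assms by (simp add: div_greater_zero_iff)
  have cop: "coprime (9 * t + c) 9" if "coprime c 9" for t c :: nat
    using that by (metis coprime_commute gcd_add_mult coprime_iff_gcd_eq_1 add.commute mult.commute)
  have five: "\<exists>t. n = 9 * Suc t + 5" if "[n = 5] (mod 9)"
    using that n by (intro exI[of _ "n div 9 - 1"]) (simp add: cong_def)
  have two: "\<exists>t. n = 9 * Suc t + 2" if "[n = 2] (mod 9)"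
    using that n by (intro exI[of _ "n div 9 - 1"]) (simp add: cong_def)
  have cop5: "coprime (9 * Suc t + 5) 9" for t :: nat
    by (rule cop) (simp add: coprime_iff_gcd_eq_1 gcd_nat.simps)
  have cop2: "coprime (9 * Suc t + 2) 9" for t :: nat
    by (rule cop) (simp add: coprime_iff_gcd_eq_1 gcd_nat.simps)
  show ?thesis
  proof (intro conjI impI)
    assume "[n = 5] (mod 9)"
    then obtain t where "n = 9 * Suc t + 5" using five by blast
    then show "ratfun_cong
          (\<Sum>k = 0..n - 1.
             qpochhammer (qvar powi (-1)) (qvar ^ 9) k ^ 2 *
             qpochhammer (qvar powi (-7)) (qvar ^ 9) k * qvar ^ (9 * k) /
             qpochhammer (qvar ^ 9) (qvar ^ 9) k ^ 3)
          0 (cyclotomic n ^ 2)"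
      \<comment> \<open>Modulo 9, \<open>m\<close> solves \<open>m n = - r\<close> and
        \<open>m'\<close> solves \<open>m' n = s\<close>; here \<open>m = 7\<close> and
        \<open>m' = 5\<close>. These determine \<open>N\<close> and \<open>i\<close>; the
        instantiation order is \<open>N\<close>, \<open>m\<close>, \<open>i\<close>,
        \<open>m'\<close>.\<close>
      using cop5[of t] ratfun_cong_sum[of n 1 7 "7 * Suc t + 3" 7 "5 * Suc t + 1" 5] by simp
  next
    assume "[n = 2] (mod 9) \<or> [n = 5] (mod 9)"
    then show "ratfun_cong
          (\<Sum>k = 0..n - 1.
             qpochhammer (qvar powi (-2)) (qvar ^ 9) k ^ 2 *
             qpochhammer (qvar powi (-5)) (qvar ^ 9) k * qvar ^ (9 * k) /
             qpochhammer (qvar ^ 9) (qvar ^ 9) k ^ 3)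
          0 (cyclotomic n ^ 2)"
    proof
      assume "[n = 2] (mod 9)"
      then obtain t where "n = 9 * Suc t + 2" using two by blast
      then show ?thesis
        \<comment> \<open>Now \<open>m = 8\<close> and \<open>m' = 7\<close>; the bound
          \<open>i < N - 1\<close> reads \<open>7 (t+1) < 8 (t+1)\<close> and rests on the positive
          quotient.\<close>
        using cop2[of t] ratfun_cong_sum[of n 2 5 "8 * Suc t + 1" 8 "7 * Suc t" 7] by simp
    next
      assume "[n = 5] (mod 9)"
      then obtain t where "n = 9 * Suc t + 5" using five by blast
      then show ?thesis
        \<comment> \<open>Now \<open>m = 5\<close> and \<open>m' = 1\<close>: the vanishing factor
          is \<open>1 - q^n\<close> itself.\<close>
        using cop5[of t] ratfun_cong_sum[of n 2 5 "5 * Suc t + 2" 5 t 1] by simp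
    qed
  next
    assume "[n = 2] (mod 9)"
    then obtain t where "n = 9 * Suc t + 2" using two by blast
    then show "ratfun_cong
          (\<Sum>k = 0..n - 1.
             qpochhammer (qvar powi (-4)) (qvar ^ 9) k ^ 2 *
             qpochhammer (qvar powi (-1)) (qvar ^ 9) k * qvar ^ (9 * k) /
             qpochhammer (qvar ^ 9) (qvar ^ 9) k ^ 3)
          0 (cyclotomic n ^ 2)"
      \<comment> \<open>Now \<open>m = 7\<close> and \<open>m' = 5\<close>; the bound on
        \<open>i\<close> reads \<open>5 (t+1) < 7 (t+1)\<close>.\<close>
      using cop2[of t] ratfun_cong_sum[of n 4 1 "7 * Suc t + 1" 7 "5 * Suc t" 5] by simp
  qed
qed

end
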